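(* Let $G$ be a $2$-connected nontrivial uniquely $C_9$-saturated graph whose longest even cycle of length at most $12$ has length $6$, and let $u,v$ be distinct nonadjacent vertices of $G$. Then each of the following is impossible (i.e. no such $G$ with such $u,v$ exists): (i) some common neighbour $w$ of $u$ and $v$ satisfies $|N(w)\setminus\{u,v\}|\le 1$; (ii) every neighbour of $u$ is a common neighbour of $u$ and $v$, in particular $N(u)\subseteq N(v)$.
   Context: All graphs are finite and simple; $N(x)$ denotes the neighbourhood of $x$ in $G$. A graph $G$ is uniquely $C_9$-saturated if it contains no cycle of length $9$ and, for every edge $e$ of the complement $\overline{G}$, $G+e$ contains exactly one cycle of length $9$; it is nontrivial if $|V(G)|\ge 9$. "Longest even cycle of length at most $12$" means a longest cycle among all even cycles of $G$ whose length is at most $12$; so here $G$ contains a $6$-cycle but no cycle of length $8$, $10$ or $12$. *)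

theory Defs
  imports Main
begin

definition sgraph :: "'a set \<Rightarrow> 'a set set \<Rightarrow> bool" where
  "sgraph V E \<longleftrightarrow> finite V \<and> (\<forall>e\<in>E. e \<subseteq> V \<and> card e = 2)"

definition nbhd :: "'a set set \<Rightarrow> 'a \<Rightarrow> 'a set" where
  "nbhd E x = {y. {x, y} \<in> E}"

definition complement_edges :: "'a set \<Rightarrow> 'a set set \<Rightarrow> 'a set set" where
  "complement_edges V E = {e. e \<subseteq> V \<and> card e = 2} - E"

definition connected_graph :: "'a set \<Rightarrow> 'a set set \<Rightarrow> bool" where
  "connected_graph V E \<longleftrightarrow>
     V \<noteq> {} \<and> (\<forall>x\<in>V. \<forall>y\<in>V. (x, y) \<in> {(a, b). {a, b} \<in> E}\<^sup>*)"

definition k_connected :: "nat \<Rightarrow> 'a set \<Rightarrow> 'a set set \<Rightarrow> bool" where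
  "k_connected k V E \<longleftrightarrow>
     k < card V \<and>
     (\<forall>X\<subseteq>V. card X < k \<longrightarrow> connected_graph (V - X) {e \<in> E. e \<inter> X = {}})"

definition closed_walk_edges :: "'a list \<Rightarrow> 'a set set" where
  "closed_walk_edges xs = {{xs ! i, xs ! (Suc i mod length xs)} | i. i < length xs}"

text \<open>
  A cycle is a subgraph and is represented by its edge set, which determines it. Hence the
  \<open>2 * k\<close> vertex sequences that traverse the same cycle are counted once.
\<close>

definition cycles :: "nat \<Rightarrow> 'a set set \<Rightarrow> 'a set set set" where
  "cycles k E =
     {C. \<exists>xs. 3 \<le> k \<and> length xs = k \<and> distinct xs \<and> C = closed_walk_edges xs \<and> C \<subseteq> E}"

definition uniquely_cycle_saturated :: "nat \<Rightarrow> 'a set \<Rightarrow> 'a set set \<Rightarrow> bool" where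
  "uniquely_cycle_saturated k V E \<longleftrightarrow>
     cycles k E = {} \<and> (\<forall>e\<in>complement_edges V E. \<exists>!C. C \<in> cycles k (insert e E))"

definition longest_even_cycle_upto :: "nat \<Rightarrow> 'a set set \<Rightarrow> nat \<Rightarrow> bool" where
  "longest_even_cycle_upto m E l \<longleftrightarrow>
     even l \<and> l \<le> m \<and> cycles l E \<noteq> {} \<and>
     (\<forall>j. even j \<and> j \<le> m \<and> cycles j E \<noteq> {} \<longrightarrow> j \<le> l)"

end

theory Submission
  imports Defs
begin

text \<open>
  Saturation supplies a path on nine vertices from \<open>u\<close> to \<open>v\<close>: it is what remains of a
  \<open>9\<close>-cycle of \<open>G + uv\<close> when the edge \<open>uv\<close> is removed. Write it \<open>x\<^sub>0, \<dots>, x\<^sub>8\<close> with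
  \<open>x\<^sub>0 = u\<close> and \<open>x\<^sub>8 = v\<close>. Short detours through a common neighbour of \<open>u\<close> and \<open>v\<close> close pieces
  of this path to even cycles of forbidden length.

  If every neighbour of \<open>u\<close> is a neighbour of \<open>v\<close>, then \<open>x\<^sub>1\<close> is adjacent to \<open>x\<^sub>8\<close>, and
  \<open>x\<^sub>1, \<dots>, x\<^sub>8\<close> is an \<open>8\<close>-cycle. Now let \<open>w\<close> be any common neighbour. It lies on the path, since
  otherwise \<open>w, x\<^sub>0, \<dots>, x\<^sub>8\<close> is a \<open>10\<close>-cycle. It is neither \<open>x\<^sub>1\<close> nor \<open>x\<^sub>7\<close>, since
  otherwise \<open>x\<^sub>1, \<dots>, x\<^sub>8\<close> or \<open>x\<^sub>0, \<dots>, x\<^sub>7\<close> is an \<open>8\<close>-cycle. Hence both neighbours of \<open>w\<close> on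
  the path are different from \<open>u\<close> and \<open>v\<close>, so that \<open>w\<close> has at least two neighbours besides
  \<open>u\<close> and \<open>v\<close>.
\<close>

definition path_between :: "'a set set \<Rightarrow> 'a \<Rightarrow> 'a list \<Rightarrow> 'a \<Rightarrow> bool" where
  "path_between E u xs v \<longleftrightarrow>
     xs \<noteq> [] \<and> distinct xs \<and> hd xs = u \<and> last xs = v \<and> successively (\<lambda>x y. {x, y} \<in> E) xs"

lemma path_between_rev: "path_between E u xs v \<Longrightarrow> path_between E v (rev xs) u"
  by (auto simp: path_between_def successively_rev hd_rev last_rev insert_commute)

text \<open>
  Separating the closing edge from the others removes the modular index, so that cycles can be
  built and taken apart with list operations.
\<close>

lemma closed_walk_edges_subset_iff:
  assumes "xs \<noteq> []"
  shows "closed_walk_edges xs \<subseteq> E \<longleftrightarrow>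
    successively (\<lambda>x y. {x, y} \<in> E) xs \<and> {last xs, hd xs} \<in> E"
proof -
  let ?n = "length xs" and ?e = "\<lambda>i. {xs ! i, xs ! (Suc i mod length xs)}"
  have "closed_walk_edges xs \<subseteq> E \<longleftrightarrow> (\<forall>i<?n. ?e i \<in> E)"
    by (auto simp: closed_walk_edges_def)
  also have "\<dots> \<longleftrightarrow> (\<forall>i. Suc i < ?n \<longrightarrow> ?e i \<in> E) \<and> ?e (?n - 1) \<in> E"
  proof -
    have "i < ?n \<longleftrightarrow> Suc i < ?n \<or> i = ?n - 1" for i
      using assms by (cases xs) auto
    then show ?thesis by blast
  qed
  also have "\<dots> \<longleftrightarrow> successively (\<lambda>x y. {x, y} \<in> E) xs \<and> {last xs, hd xs} \<in> E"
    using assms by (simp add: successively_conv_nth last_conv_nth hd_conv_nth)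
  finally show ?thesis .
qed

lemma path_between_closes_to_cycle:
  assumes "path_between E u xs v" "{u, v} \<in> E" "3 \<le> length xs"
  shows "cycles (length xs) E \<noteq> {}"
  using assms closed_walk_edges_subset_iff[of xs E]
  by (auto simp: cycles_def path_between_def insert_commute)

lemma closed_walk_edges_rotate1: "closed_walk_edges (rotate1 xs) \<subseteq> E \<longleftrightarrow> closed_walk_edges xs \<subseteq> E"
proof (cases xs)
  case (Cons x ys)
  then show ?thesis
    using closed_walk_edges_subset_iff[of xs E] closed_walk_edges_subset_iff[of "ys @ [x]" E]
    by (cases ys) (auto simp: successively_append_iff insert_commute successively_Cons)
qed simp

lemma closed_walk_edges_rotate: "closed_walk_edges (rotate n xs) \<subseteq> E \<longleftrightarrow> closed_walk_edges xs \<subseteq> E"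
  by (induction n) (simp_all add: closed_walk_edges_rotate1)

text \<open>
  A cycle that appears with the edge \<open>uv\<close> traverses this edge. Rotating the cycle so that \<open>uv\<close>
  becomes the closing edge leaves a path whose other edges are old.
\<close>

lemma new_cycle_gives_path:
  assumes old: "cycles k E = {}" and new: "cycles k (insert {u, v} E) \<noteq> {}"
  shows "\<exists>xs. path_between E u xs v \<and> length xs = k"
proof -
  obtain xs where xs: "3 \<le> k" "length xs = k" "distinct xs"
      "closed_walk_edges xs \<subseteq> insert {u, v} E"
    using new by (auto simp: cycles_def)
  have "\<not> closed_walk_edges xs \<subseteq> E"
    using old xs by (auto simp: cycles_def)
  then obtain i where i: "i < k" "{xs ! i, xs ! (Suc i mod k)} \<notin> E"
    using xs(2) by (auto simp: closed_walk_edges_def)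
  define ys where "ys = rotate (Suc i) xs"
  have ys: "length ys = k" "distinct ys" "ys \<noteq> []"
    using xs by (auto simp: ys_def simp del: rotate_Suc)
  have "(Suc i + (k - 1)) mod k = i"
    using i by simp
  then have ends: "hd ys = xs ! (Suc i mod k)" "last ys = xs ! i"
    using xs i ys nth_rotate[of 0 xs "Suc i"] nth_rotate[of "k - 1" xs "Suc i"]
    by (simp_all add: ys_def hd_conv_nth last_conv_nth del: rotate_Suc)
  have walk: "successively (\<lambda>x y. {x, y} \<in> insert {u, v} E) ys"
      "{last ys, hd ys} \<in> insert {u, v} E"
    using xs(4) closed_walk_edges_subset_iff[OF ys(3)]
    by (simp_all only: ys_def closed_walk_edges_rotate)
  have uv: "{last ys, hd ys} = {u, v}"
    using walk(2) i(2) ends by auto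
  have "{ys ! j, ys ! Suc j} \<in> E" if j: "Suc j < k" for j
  proof -
    have "{ys ! j, ys ! Suc j} \<in> insert {u, v} E"
      using walk(1) j ys(1) by (simp add: successively_conv_nth)
    \<comment> \<open>As \<open>k \<noteq> 2\<close>, no two consecutive indices are the two ends.\<close>
    moreover have "{ys ! j, ys ! Suc j} \<noteq> {ys ! (k - 1), ys ! 0}"
      using j ys(1,2) xs(1) by (auto simp: doubleton_eq_iff nth_eq_iff_index_eq)
    ultimately show ?thesis
      using uv ys by (simp add: hd_conv_nth last_conv_nth)
  qed
  then have path: "path_between E (hd ys) ys (last ys)"
    using ys by (simp add: path_between_def successively_conv_nth)
  from uv consider "hd ys = u" "last ys = v" | "hd ys = v" "last ys = u"
    by (auto simp: doubleton_eq_iff)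
  then show ?thesis
  proof cases
    case 1
    then show ?thesis
      using path ys(1) by blast
  next
    case 2
    then have "path_between E u (rev ys) v"
      using path_between_rev[OF path] by simp
    then show ?thesis
      using ys(1) by (intro exI[of _ "rev ys"]) simp
  qed
qed

lemma chord_from_second_vertex_gives_cycle:
  assumes "path_between E u xs v" "length xs = Suc k" "3 \<le> k" "{xs ! 1, v} \<in> E"
  shows "cycles k E \<noteq> {}"
proof -
  obtain x ys where xs: "xs = x # ys" and ys: "length ys = k"
    using assms(2) by (cases xs) auto
  have "ys \<noteq> []"
    using ys assms(3) by auto
  then have "path_between E (xs ! 1) ys v"
    using assms(1) by (auto simp: xs path_between_def hd_conv_nth successively_Cons)
  then show ?thesis
    using path_between_closes_to_cycle ys assms(3,4) by metis
qed

lemma common_neighbour_off_path_gives_cycle: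
  assumes "path_between E u xs v" "w \<notin> set xs" "2 \<le> length xs" "{u, w} \<in> E" "{v, w} \<in> E"
  shows "cycles (Suc (length xs)) E \<noteq> {}"
proof -
  have "path_between E w (w # xs) v"
    using assms by (auto simp: path_between_def successively_Cons insert_commute)
  then show ?thesis
    using path_between_closes_to_cycle[of E w "w # xs" v] assms by (simp add: insert_commute)
qed

text \<open>
  The path cannot avoid \<open>w\<close>, and \<open>w\<close> is not next to an end of the path, because each of these
  positions closes a cycle. So the two neighbours of \<open>w\<close> on the path are inner vertices.
\<close>

lemma common_neighbour_has_two_other_neighbours:
  assumes G: "sgraph V E"
    and path: "path_between E u xs v" and len: "length xs = Suc k" and k: "3 \<le> k"
    and no_cycle: "cycles k E = {}" "cycles (k + 2) E = {}"
    and w: "{u, w} \<in> E" "{v, w} \<in> E"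
  shows "2 \<le> card (nbhd E w - {u, v})"
proof -
  have "w \<in> set xs"
    using common_neighbour_off_path_gives_cycle[OF path _ _ w] no_cycle(2) len k by auto
  then obtain i where i: "i \<le> k" "xs ! i = w"
    using len by (auto simp: in_set_conv_nth less_Suc_eq_le)
  have ends: "xs ! 0 = u" "xs ! k = v" and dist: "distinct xs"
    using path len by (auto simp: path_between_def hd_conv_nth last_conv_nth)
  have "u \<noteq> w" "v \<noteq> w"
    using w G by (auto simp: sgraph_def)
  moreover have "i \<noteq> 1"
    using chord_from_second_vertex_gives_cycle[OF path len k] no_cycle(1) w(2) i(2)
    by (auto simp: insert_commute)
  moreover have "i \<noteq> k - 1"
  proof
    assume "i = k - 1"
    then have "rev xs ! 1 = w"
      using i(2) len k by (simp add: rev_nth)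
    then show False
      using chord_from_second_vertex_gives_cycle[OF path_between_rev[OF path] _ k] len
        no_cycle(1) w(1) by (auto simp: insert_commute)
  qed
  ultimately have inner: "2 \<le> i" "Suc i < k"
    using i ends by (cases "i = 0"; cases "i = k"; auto)+
  define a b where "a = xs ! (i - 1)" and "b = xs ! Suc i"
  have step: "Suc j < length xs \<Longrightarrow> {xs ! j, xs ! Suc j} \<in> E" for j
    using path by (simp add: path_between_def successively_conv_nth)
  have "a \<in> nbhd E w" "b \<in> nbhd E w"
    using step[of "i - 1"] step[of i] inner i(2) len
    by (auto simp: nbhd_def a_def b_def insert_commute)
  moreover have "a \<noteq> b" "a \<notin> {u, v}" "b \<notin> {u, v}"
    using inner len dist
    by (auto simp: a_def b_def ends[symmetric] nth_eq_iff_index_eq)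
  ultimately have "{a, b} \<subseteq> nbhd E w - {u, v}" "card {a, b} = 2"
    by auto
  moreover have "finite (nbhd E w)"
    by (rule finite_subset[of _ V]) (use G in \<open>auto simp: nbhd_def sgraph_def\<close>)
  ultimately show ?thesis
    by (metis card_mono finite_Diff)
qed

theorem lemma6p3:
  fixes V :: "'a set" and E :: "'a set set" and u v :: 'a
  assumes "sgraph V E"
    and "k_connected 2 V E"
    and "9 \<le> card V"
    and "uniquely_cycle_saturated 9 V E"
    and "longest_even_cycle_upto 12 E 6"
    and "u \<in> V" and "v \<in> V" and "u \<noteq> v" and "{u, v} \<notin> E"
  shows "\<not> (\<exists>w \<in> nbhd E u \<inter> nbhd E v. card (nbhd E w - {u, v}) \<le> 1) \<and>
    \<not> (\<forall>x \<in> nbhd E u. x \<in> nbhd E u \<inter> nbhd E v)"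
proof -
  have "cycles j E = {}" if "even j" "j \<le> 12" "6 < j" for j
    using assms(5) that unfolding longest_even_cycle_upto_def by (metis not_le)
  then have no_cycle: "cycles 8 E = {}" "cycles (8 + 2) E = {}"
    by simp_all
  have "{u, v} \<in> complement_edges V E"
    using assms by (auto simp: complement_edges_def)
  then have "cycles 9 E = {}" "cycles 9 (insert {u, v} E) \<noteq> {}"
    using assms(4) unfolding uniquely_cycle_saturated_def by blast+
  then obtain xs where path: "path_between E u xs v" and "length xs = 9"
    using new_cycle_gives_path[of 9 E u v] by auto
  then have len: "length xs = Suc 8"
    by simp
  have "2 \<le> card (nbhd E w - {u, v})" if "w \<in> nbhd E u \<inter> nbhd E v" for w
    by (rule common_neighbour_has_two_other_neighbours[OF assms(1) path len _ no_cycle])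
      (use that in \<open>simp_all add: nbhd_def\<close>)
  moreover have "xs ! 1 \<in> nbhd E u"
    using path len by (auto simp: path_between_def nbhd_def successively_conv_nth hd_conv_nth)
  moreover have "xs ! 1 \<notin> nbhd E v"
    using chord_from_second_vertex_gives_cycle[OF path len] no_cycle(1)
    by (auto simp: nbhd_def insert_commute)
  ultimately show ?thesis
    by (metis IntD2 Suc_1 not_less_eq_eq)
qed

end
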